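(* Let $T$ be a tree and let $r$ be an integer with $1\leq r\leq 4$. Then a maximum sized star of independent $r$-sets of vertices of $T$ is centered at a leaf; that is, there exists a leaf $x$ of $T$ such that $|\mathcal{J}^{(r)}_v(T)|\leq |\mathcal{J}^{(r)}_x(T)|$ for every $v\in V(T)$.
   Context: Trees are finite and nonempty. For a graph $G$, $v\in V(G)$ and $r\geq 1$, $\mathcal{J}^{(r)}_v(G)$, the star centered at $v$, is the family of all independent sets of $G$ of size $r$ that contain $v$. A leaf is a vertex that is not internal, where a vertex is internal if its degree is at least $2$ (so the unique vertex of the one-vertex tree counts as a leaf). *)

theory Defs
  imports "Graph_Theory.Graph_Theory"
begin

text \<open>
  A finite simple graph is an element of the library locale \<open>graph\<close>: a finite, loop-free, symmetric
  digraph without parallel arcs, in which every undirected edge appears as two opposite arcs.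
  The library predicate \<open>tree\<close> is not the undirected notion for such graphs, because going along an
  edge and back is a directed cycle of length 2 in the sense of \<open>pre_digraph.cycle\<close>. The cycles
  of the underlying undirected graph are exactly the library cycles of length at least 3.
  The library predicate \<open>connected\<close> includes that the vertex set is nonempty.
\<close>

definition undirected_tree :: "('a, 'b) pre_digraph \<Rightarrow> bool" where
  "undirected_tree T \<longleftrightarrow>
     graph T \<and> connected T \<and> \<not> (\<exists>p. pre_digraph.cycle T p \<and> 3 \<le> length p)"

text \<open>In a symmetric digraph without parallel arcs, \<open>out_degree\<close> is the undirected degree.\<close>

definition internal_vertex :: "('a, 'b) pre_digraph \<Rightarrow> 'a \<Rightarrow> bool" where
  "internal_vertex G v \<longleftrightarrow> v \<in> verts G \<and> 2 \<le> out_degree G v"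

definition leaf :: "('a, 'b) pre_digraph \<Rightarrow> 'a \<Rightarrow> bool" where
  "leaf G v \<longleftrightarrow> v \<in> verts G \<and> \<not> internal_vertex G v"

definition independent_set :: "('a, 'b) pre_digraph \<Rightarrow> 'a set \<Rightarrow> bool" where
  "independent_set G S \<longleftrightarrow> S \<subseteq> verts G \<and> (\<forall>u\<in>S. \<forall>w\<in>S. \<not> u \<rightarrow>\<^bsub>G\<^esub> w)"

definition star :: "('a, 'b) pre_digraph \<Rightarrow> nat \<Rightarrow> 'a \<Rightarrow> 'a set set" where
  "star G r v = {S. independent_set G S \<and> card S = r \<and> v \<in> S}"

end

theory Submission
  imports Defs
begin

text \<open>
  A leaf of maximum star among the leaves is a maximum among all vertices, because every internal
  vertex \<open>v\<close> is beaten by some leaf. Write \<open>x \<sim> y\<close> for adjacency. Exchanging \<open>v\<close> for a leaf \<open>l\<close> in an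
  independent set that contains \<open>v\<close> but not \<open>l\<close> gives an independent set again, unless the set
  contains the neighbour \<open>p\<close> of \<open>l\<close>. If \<open>p = v\<close> or \<open>p \<sim> v\<close>, this obstruction cannot occur, so a leaf
  within distance two of \<open>v\<close> is at least as good as \<open>v\<close> (\<open>near_leaf_star_ge\<close>).

  Otherwise no leaf is within distance two of \<open>v\<close>, and then every leaf \<open>l\<close> beats \<open>v\<close>
  (\<open>far_leaf_star_ge\<close>). The obstructed sets are \<open>{v, p} \<union> Q\<close> with at most two elements in \<open>Q\<close>, since
  \<open>r \<le> 4\<close>. The targets not yet used are those that contain \<open>l\<close> and a neighbour of \<open>v\<close>. Fix two
  neighbours \<open>u1\<close> and \<open>u2\<close> of \<open>v\<close>. Send \<open>{v, p} \<union> Q\<close> to \<open>{l, u1} \<union> Q\<close> if this is independent, and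
  otherwise to \<open>{l, u2} \<union> Q\<close> if that is. Both fail only if \<open>Q = {a, b}\<close> with \<open>a \<sim> u1\<close> and \<open>b \<sim> u2\<close>, as
  no vertex other than \<open>v\<close> is adjacent to both \<open>u1\<close> and \<open>u2\<close>. Here \<open>a\<close> and \<open>b\<close> are at distance two from
  \<open>v\<close>, so they are not leaves, and the path \<open>a - u1 - v - u2 - b\<close> extends to a path
  \<open>a' - a - u1 - v - u2 - b - b'\<close>. The image is then \<open>{l, u2, a', b'}\<close>. It differs from the images
  \<open>{l, u2} \<union> Q\<close> used before because \<open>u2\<close> was chosen only when \<open>u1\<close> had a neighbour in \<open>Q\<close>, whereas \<open>u1\<close> is
  adjacent to neither \<open>a'\<close> nor \<open>b'\<close>; and \<open>{a, b}\<close> can be read off from \<open>{a', b'}\<close> because there are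
  no cycles of length 4 or 6.
\<close>

section \<open>Forests as graphs without long library cycles\<close>

text \<open>Length 2 is admitted because the walk along an edge and back is a cycle for the library.\<close>
locale forest = graph +
  assumes no_long_cycle: "cycle p \<Longrightarrow> \<not> 3 \<le> length p"
begin

abbreviation adjacent :: "'a \<Rightarrow> 'a \<Rightarrow> bool" (infix \<open>\<sim>\<close> 50) where
  "x \<sim> y \<equiv> x \<rightarrow>\<^bsub>G\<^esub> y"

lemma adjacent_sym: "x \<sim> y \<longleftrightarrow> y \<sim> x"
  using arcs_ends_symmetric[OF sym_arcs, of x y] arcs_ends_symmetric[OF sym_arcs, of y x] by iprover

lemma awalk_of_successively:
  assumes "successively (\<sim>) xs" "xs \<noteq> []" "hd xs \<in> verts G"
  shows "\<exists>p. awalk (hd xs) p (last xs) \<and> awalk_verts (hd xs) p = xs"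
  using assms
proof (induction xs)
  case Nil
  then show ?case by simp
next
  case (Cons x xs)
  show ?case
  proof (cases "xs = []")
    case True
    with Cons.prems have "awalk x [] x" by (simp add: awalk_Nil_iff)
    then show ?thesis using True by (intro exI[of _ "[]"]) simp
  next
    case False
    with Cons.prems have xd: "x \<sim> hd xs" and "successively (\<sim>) xs"
      by (auto simp: successively_Cons)
    moreover from xd have "hd xs \<in> verts G" by (rule adj_in_verts)
    ultimately obtain p where p: "awalk (hd xs) p (last xs)" "awalk_verts (hd xs) p = xs"
      using Cons.IH False by blast
    from xd obtain e where "e \<in> arcs G" "tail G e = x" "head G e = hd xs"
      by (rule reachableE)
    with p False have "awalk x (e # p) (last (x # xs)) \<and> awalk_verts x (e # p) = x # xs"
      by (simp add: awalk_Cons_iff)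
    then show ?thesis by (intro exI[of _ "e # p"]) simp
  qed
qed

text \<open>
  Cycles are given as lists of arcs in the library, but are far easier to exhibit as lists of
  vertices; all later uses of acyclicity go through this translation.
\<close>
lemma no_cyclic_list:
  assumes "successively (\<sim>) xs" "last xs \<sim> hd xs" "distinct xs" "3 \<le> length xs"
  shows False
proof -
  obtain x ys where xs: "xs = x # ys" using assms(4) by (cases xs) auto
  then have "ys \<noteq> []" using assms(4) by auto
  \<comment> \<open>Closing the list into a walk repeats its first vertex; the library definition of a cycle
    allows this by asking for distinctness of the tail only.\<close>
  have "successively (\<sim>) (xs @ [x])"
    using assms(1,2) xs \<open>ys \<noteq> []\<close> by (simp add: successively_Cons successively_append_iff)
  moreover have "x \<in> verts G" using adj_in_verts(2)[OF assms(2)] xs by simp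
  ultimately obtain p where p: "awalk x p x" "awalk_verts x p = xs @ [x]"
    using awalk_of_successively[of "xs @ [x]"] xs by auto
  have len: "length p = length xs"
    using p(2) length_awalk_verts[of x p] by simp
  have "distinct (tl (awalk_verts x p))"
    using p(2) assms(3) xs by simp
  moreover have "p \<noteq> []" using len assms(4) by auto
  ultimately have "cycle p" using p(1) by (auto simp only: cycle_def)
  then show False using no_long_cycle[of p] len assms(4) by simp
qed

lemma no_triangle: "x \<sim> y \<Longrightarrow> y \<sim> z \<Longrightarrow> z \<sim> x \<Longrightarrow> False"
  using no_cyclic_list[of "[x, y, z]"] by (auto dest: adj_not_same)

lemma common_neighbour_unique:
  "u \<noteq> v \<Longrightarrow> u \<sim> x \<Longrightarrow> v \<sim> x \<Longrightarrow> u \<sim> y \<Longrightarrow> v \<sim> y \<Longrightarrow> x = y"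
  using no_cyclic_list[of "[u, x, v, y]"] by (auto simp: adjacent_sym dest: adj_not_same)

section \<open>Leaves and internal vertices\<close>

lemma leaf_neighbour_unique:
  assumes "leaf G l" "l \<sim> x" "l \<sim> y" shows "x = y"
proof (rule ccontr)
  assume "x \<noteq> y"
  from assms(2) obtain e where e: "e \<in> arcs G" "tail G e = l" "head G e = x" by (rule reachableE)
  from assms(3) obtain f where f: "f \<in> arcs G" "tail G f = l" "head G f = y" by (rule reachableE)
  have "card {e, f} \<le> card (out_arcs G l)"
    using e f by (intro card_mono) auto
  moreover have "e \<noteq> f" using e f \<open>x \<noteq> y\<close> by auto
  ultimately have "2 \<le> out_degree G l" by (simp add: out_degree_def)
  then show False using assms(1) by (simp add: leaf_def internal_vertex_def)
qed

lemma internal_vertex_other_neighbour: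
  assumes "internal_vertex G x" obtains y where "x \<sim> y" "y \<noteq> z"
proof -
  have "card (out_arcs G x) \<ge> 2"
    using assms by (simp add: internal_vertex_def out_degree_def)
  then have "\<not> card (out_arcs G x) \<le> Suc 0" by simp
  then obtain e f where ef: "e \<in> out_arcs G x" "f \<in> out_arcs G x" "e \<noteq> f"
    using card_le_Suc0_iff_eq[OF finite_out_arcs] by blast
  then have "head G e \<noteq> head G f"
    using no_multi_arcs by (auto simp: arc_to_ends_def)
  moreover have "x \<sim> head G e" "x \<sim> head G f"
    using ef by (auto simp: arcs_ends_conv intro: rev_image_eqI)
  ultimately show thesis using that by metis
qed

text \<open>
  The first vertex of a longest path is a leaf: a second neighbour would either prolong the path or
  lie on it, and in the latter case close a cycle.
\<close>
lemma leaf_exists: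
  assumes "verts G \<noteq> {}" shows "\<exists>x. leaf G x"
proof (rule ccontr)
  assume no_leaf: "\<nexists>x. leaf G x"
  define P where "P xs \<longleftrightarrow>
    successively (\<sim>) xs \<and> distinct xs \<and> xs \<noteq> [] \<and> set xs \<subseteq> verts G" for xs
  obtain x0 where "x0 \<in> verts G" using assms by auto
  then have "P [x0]" by (simp add: P_def)
  moreover have "\<forall>xs. P xs \<longrightarrow> length xs < Suc (card (verts G))"
    unfolding P_def by (metis card_mono distinct_card finite_verts less_Suc_eq_le)
  ultimately obtain xs where xs: "P xs" and longest: "\<And>ys. P ys \<Longrightarrow> length ys \<le> length xs"
    using ex_has_greatest_nat[of P "[x0]" length "Suc (card (verts G))"] by auto
  obtain x ys where xs_eq: "xs = x # ys" using xs unfolding P_def by (cases xs) auto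
  have "internal_vertex G x"
    using no_leaf xs by (auto simp: P_def xs_eq leaf_def)
  then obtain z where z: "x \<sim> z" "ys = [] \<or> z \<noteq> hd ys"
    using internal_vertex_other_neighbour[of x "hd ys"] by blast
  have "z \<in> set xs"
  proof (rule ccontr)
    assume "z \<notin> set xs"
    then have "P (z # xs)"
      using xs z adj_in_verts(2)[OF z(1)] unfolding P_def xs_eq
      by (auto simp: successively_Cons adjacent_sym[of z])
    then show False using longest by fastforce
  qed
  moreover have "z \<noteq> x" using z adj_not_same by blast
  ultimately have "z \<in> set ys" using xs_eq by auto
  then obtain as bs where ys: "ys = as @ z # bs" by (auto simp: in_set_conv_decomp)
  have "as \<noteq> []" using z ys by auto
  then have "3 \<le> length (x # as @ [z])" by (cases as) auto
  moreover have "successively (\<sim>) (x # as @ [z])" "distinct (x # as @ [z])"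
    using xs unfolding P_def xs_eq ys
    by (auto simp: successively_Cons successively_append_iff hd_append split: if_splits)
  ultimately show False using no_cyclic_list[of "x # as @ [z]"] z by (auto simp: adjacent_sym[of z])
qed

section \<open>Comparing stars\<close>

lemma finite_star: "finite (star G r v)"
  by (rule finite_subset[of _ "Pow (verts G)"]) (auto simp: star_def independent_set_def)

lemma finite_independent_set: "independent_set G S \<Longrightarrow> finite S"
  unfolding independent_set_def using finite_subset finite_verts by blast

lemma independent_set_insert:
  "independent_set G (insert x S) \<longleftrightarrow>
     x \<in> verts G \<and> independent_set G S \<and> (\<forall>y\<in>S. \<not> x \<sim> y)"
proof -
  have "\<not> x \<sim> x" using adj_not_same by iprover
  moreover have "(\<forall>y\<in>S. \<not> y \<sim> x) \<longleftrightarrow> (\<forall>y\<in>S. \<not> x \<sim> y)"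
    using adjacent_sym[of _ x] by (intro ball_cong refl) iprover
  ultimately show ?thesis
    unfolding independent_set_def insert_subset by (simp only: ball_simps ball_conj_distrib) iprover
qed

text \<open>
  Instead of defining an injection between stars and proving it injective, it is enough to name a
  decoding map \<open>g\<close> and to produce for every set a code that \<open>g\<close> sends back to it. This turns the
  pairwise comparison of the cases of an injection into one check per case.
\<close>
lemma star_card_le_by_decoding:
  assumes "\<And>S. S \<in> star G r v \<Longrightarrow> \<exists>S'\<in>star G r l. g S' = S"
  shows "card (star G r v) \<le> card (star G r l)"
proof -
  have "star G r v \<subseteq> g ` star G r l" using assms by force
  then show ?thesis by (rule surj_card_le[OF finite_star])
qed

lemma exchange_mem_star:
  assumes S: "S \<in> star G r v" and "l \<notin> S" "l \<in> verts G"
    and far: "\<And>x. l \<sim> x \<Longrightarrow> x \<notin> S - {v}"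
  shows "insert l (S - {v}) \<in> star G r l"
proof -
  have "independent_set G (insert l (S - {v}))"
    unfolding independent_set_insert
    using S assms(3) far by (auto simp: star_def independent_set_def)
  moreover have "card (insert l (S - {v})) = r"
    using S assms(2) finite_independent_set[of S] card_Suc_Diff1[of S v]
    by (auto simp: star_def)
  ultimately show ?thesis by (simp add: star_def)
qed

text \<open>
  An independent set that contains \<open>v\<close> contains no neighbour of \<open>l\<close> except possibly \<open>v\<close>, so nothing
  obstructs exchanging \<open>v\<close> for \<open>l\<close>. Sets that contain both vertices are left alone.
\<close>
lemma near_leaf_star_ge:
  assumes l: "leaf G l" and near: "\<And>p. l \<sim> p \<Longrightarrow> p = v \<or> v \<sim> p"
  shows "card (star G r v) \<le> card (star G r l)"
proof (cases "v = l")
  case False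
  define g where "g S = (if v \<in> S then S else insert v (S - {l}))" for S
  show ?thesis
  proof (rule star_card_le_by_decoding[where g = g])
    fix S assume S: "S \<in> star G r v"
    show "\<exists>S'\<in>star G r l. g S' = S"
    proof (cases "l \<in> S")
      case True
      then show ?thesis using S by (intro bexI[of _ S]) (auto simp: g_def star_def)
    next
      case False': False
      have "insert l (S - {v}) \<in> star G r l"
        using S False' l near by (intro exchange_mem_star) (auto simp: star_def leaf_def independent_set_def)
      moreover have "g (insert l (S - {v})) = S"
        using S False' False by (auto simp: g_def star_def)
      ultimately show ?thesis by blast
    qed
  qed
qed simp

text \<open>
  Here the neighbour \<open>p\<close> of the leaf can occur together with \<open>v\<close>, and the sets containing both are
  recoded through two neighbours of \<open>v\<close>. The hypothesis \<open>extend\<close> makes the vertices at distance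
  two from \<open>v\<close> internal, so that paths can be continued beyond them. The bound on \<open>r\<close> leaves room for at most two vertices besides \<open>v\<close> and \<open>p\<close>, so
  that both \<open>u1\<close> and \<open>u2\<close> are blocked in one way only.
\<close>
lemma far_leaf_star_ge:
  assumes l: "leaf G l" and lp: "l \<sim> p" and p: "p \<noteq> v" "\<not> v \<sim> p"
    and u: "v \<sim> u1" "v \<sim> u2" "u1 \<noteq> u2"
    and extend: "\<And>x y. v \<sim> x \<Longrightarrow> x \<sim> y \<Longrightarrow> \<exists>z. y \<sim> z \<and> z \<noteq> x"
    and r: "r \<le> 4"
  shows "card (star G r v) \<le> card (star G r l)"
proof (rule star_card_le_by_decoding)
  \<comment> \<open>The branches decode, in turn: sets that contained \<open>l\<close> and were kept; exchanges of \<open>v\<close> for \<open>l\<close>;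
    codes \<open>{l, u1} \<union> Q\<close> and \<open>{l, u2} \<union> Q\<close>, the latter used only when \<open>u1\<close> has a neighbour in \<open>Q\<close>; and
    codes \<open>{l, u2, a', b'}\<close>, where \<open>a\<close> and \<open>b\<close> are recovered as the neighbours of \<open>a'\<close> and \<open>b'\<close> at
    distance two from \<open>v\<close>.\<close>
  define g where "g S =
    (if v \<in> S then S
     else if u1 \<notin> S \<and> u2 \<notin> S then insert v (S - {l})
     else insert v (insert p
       (if u1 \<in> S \<or> (\<exists>x\<in>S. u1 \<sim> x) then S - {l, u1, u2}
        else {x. x \<noteq> v \<and> (u1 \<sim> x \<or> u2 \<sim> x) \<and> (\<exists>y\<in>S - {l, u2}. x \<sim> y)})))" for S
  have l_only: "x = p" if "l \<sim> x" for x
    using leaf_neighbour_unique[OF l lp that] by simp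
  have verts: "l \<in> verts G" "u1 \<in> verts G" "u2 \<in> verts G"
    using l u by (auto simp: leaf_def dest: adj_in_verts)
  have ne: "l \<noteq> v" "u1 \<noteq> v" "u2 \<noteq> v" "u1 \<noteq> p" "u2 \<noteq> p" "\<not> v \<sim> l" "l \<noteq> u1" "l \<noteq> u2" "l \<noteq> p"
    using p u lp l_only adj_not_same adjacent_sym by metis+
  fix S assume S: "S \<in> star G r v"
  have ind: "\<not> x \<sim> y" if "x \<in> S" "y \<in> S" for x y
    using S that by (auto simp: star_def independent_set_def)
  have vS: "v \<in> S" and SV: "S \<subseteq> verts G" and cS: "card S = r" and finS: "finite S"
    using S finite_independent_set[of S] by (auto simp: star_def independent_set_def)
  have uS: "u1 \<notin> S" "u2 \<notin> S" using u vS ind by auto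
  consider "l \<in> S" | "l \<notin> S" "p \<notin> S" | "l \<notin> S" "p \<in> S" by blast
  then show "\<exists>S'\<in>star G r l. g S' = S"
  proof cases
    case 1
    then show ?thesis using S by (intro bexI[of _ S]) (auto simp: g_def star_def)
  next
    case 2
    have "insert l (S - {v}) \<in> star G r l"
      using S 2 verts l_only by (intro exchange_mem_star) auto
    moreover have "g (insert l (S - {v})) = S"
      using 2 vS uS ne by (auto simp: g_def)
    ultimately show ?thesis by blast
  next
    case 3
    define Q where "Q = S - {v, p}"
    have S_eq: "S = insert v (insert p Q)" using vS 3 by (auto simp: Q_def)
    have Q: "v \<notin> Q" "p \<notin> Q" "u1 \<notin> Q" "u2 \<notin> Q" "l \<notin> Q" "finite Q" "Q \<subseteq> verts G"
      using uS 3 SV finS by (auto simp: Q_def)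
    have cQ: "r = card Q + 2" using cS S_eq Q p by simp
    have indQ: "\<not> x \<sim> y" if "x \<in> Q" "y \<in> Q" for x y using that ind S_eq by auto
    have l_ne: "\<not> l \<sim> x" if "x \<in> insert u1 (insert u2 Q)" for x
      using that l_only[of x] Q(2) ne by auto
    have replace: "insert l (insert u Q) \<in> star G r l"
      if "u = u1 \<or> u = u2" "\<forall>x\<in>Q. \<not> u \<sim> x" for u
    proof -
      have "independent_set G (insert l (insert u Q))"
        unfolding independent_set_insert
        using that Q(7) indQ verts l_ne by (auto simp: independent_set_def)
      moreover have "card (insert l (insert u Q)) = r" using cQ Q ne that by auto
      ultimately show ?thesis by (simp add: star_def)
    qed
    consider "\<forall>x\<in>Q. \<not> u1 \<sim> x" | "\<exists>x\<in>Q. u1 \<sim> x" "\<forall>x\<in>Q. \<not> u2 \<sim> x"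
      | a b where "a \<in> Q" "u1 \<sim> a" "b \<in> Q" "u2 \<sim> b" by blast
    then show ?thesis
    proof cases
      case 1
      have "g (insert l (insert u1 Q)) = S"
        using Q ne u(3) S_eq by (auto simp: g_def)
      then show ?thesis using replace 1 by blast
    next
      case 2
      have "g (insert l (insert u2 Q)) = S"
        using Q ne u(3) S_eq 2 by (auto simp: g_def)
      then show ?thesis using replace 2 by blast
    next
      case (3 a b)
      have ab: "a \<noteq> v" "b \<noteq> v" "a \<noteq> p" "b \<noteq> p" "\<not> a \<sim> p" "\<not> b \<sim> p" "\<not> a \<sim> v" "\<not> b \<sim> v"
        "a \<noteq> l" "b \<noteq> l"
        using 3 Q ind S_eq by auto
      have "a \<noteq> b"
        using common_neighbour_unique[of u1 u2 v a] 3 u ab adjacent_sym by metis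
      then have Q_eq: "Q = {a, b}" and r4: "r = 4"
      proof -
        have sub: "{a, b} \<subseteq> Q" using 3 by auto
        have "card {a, b} = 2" using \<open>a \<noteq> b\<close> by simp
        then have "card Q \<le> card {a, b}" using cQ r by simp
        then show "Q = {a, b}" using sub Q by (metis card_seteq)
        then show "r = 4" using cQ \<open>a \<noteq> b\<close> by simp
      qed
      \<comment> \<open>Both \<open>u1\<close> and \<open>u2\<close> are blocked: step outwards from \<open>a\<close> and \<open>b\<close>. By acyclicity
        \<open>a' - a - u1 - v - u2 - b - b'\<close> is an induced path.\<close>
      obtain a' where a': "a \<sim> a'" "a' \<noteq> u1" using extend u 3 by metis
      obtain b' where b': "b \<sim> b'" "b' \<noteq> u2" using extend u 3 by metis
      note sym = adjacent_sym
      have nab: "\<not> u2 \<sim> a" "\<not> u1 \<sim> b"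
        using common_neighbour_unique[of u1 u2 v] 3 u ab sym by metis+
      have neq: "a' \<noteq> v" "b' \<noteq> v" "a' \<noteq> p" "b' \<noteq> p" "a' \<noteq> l" "b' \<noteq> l" "a' \<noteq> u2" "b' \<noteq> u1"
        "a' \<noteq> a" "b' \<noteq> b" "a' \<noteq> b" "b' \<noteq> a" "u1 \<noteq> a" "u1 \<noteq> b" "u2 \<noteq> a" "u2 \<noteq> b"
        using a' b' ab nab l_only sym adj_not_same indQ 3 Q by metis+
      have "a' \<noteq> b'"
        using no_cyclic_list[of "[v, u1, a, a', b, u2]"] a' b' 3 u neq ab ne \<open>a \<noteq> b\<close>
        by (auto simp: adjacent_sym)
      have "\<not> a' \<sim> b'"
        using no_cyclic_list[of "[v, u1, a, a', b', b, u2]"] a' b' 3 u neq ab ne \<open>a \<noteq> b\<close> \<open>a' \<noteq> b'\<close>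
        by (auto simp: adjacent_sym)
      have "\<not> u2 \<sim> a'"
        using no_cyclic_list[of "[v, u1, a, a', u2]"] a' b' 3 u neq ab ne
        by (auto simp: adjacent_sym)
      have "\<not> u1 \<sim> b'"
        using no_cyclic_list[of "[v, u2, b, b', u1]"] a' b' 3 u neq ab ne
        by (auto simp: adjacent_sym)
      have "\<not> u1 \<sim> a'" "\<not> u2 \<sim> b'"
        using no_triangle 3 a' b' sym by metis+
      have "\<not> u2 \<sim> l" "\<not> u1 \<sim> l" using l_only ne sym by metis+
      have "\<not> a' \<sim> l" "\<not> b' \<sim> l" using l_only neq sym by metis+
      let ?S' = "{l, u2, a', b'}"
      note facts = a'(2) b'(2) neq ne \<open>a' \<noteq> b'\<close> \<open>\<not> a' \<sim> b'\<close> \<open>\<not> u2 \<sim> a'\<close> \<open>\<not> u1 \<sim> b'\<close> \<open>\<not> u1 \<sim> a'\<close> \<open>\<not> u2 \<sim> b'\<close>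
        \<open>\<not> u2 \<sim> l\<close> \<open>\<not> u1 \<sim> l\<close> \<open>\<not> a' \<sim> l\<close> \<open>\<not> b' \<sim> l\<close>
      have "independent_set G ?S'"
        unfolding independent_set_insert
        using facts a' b' verts adj_in_verts(2)[OF a'(1)] adj_in_verts(2)[OF b'(1)]
        by (auto simp: adjacent_sym[of l] independent_set_def)
      then have "?S' \<in> star G r l"
        using facts r4 by (auto simp: star_def)
      moreover have "g ?S' = S"
      proof -
        have "\<not> u1 \<sim> u2" using no_triangle u sym by metis
        have "?S' - {l, u2} = {a', b'}" using facts by auto
        then have "g ?S' = insert v (insert p
            {x. x \<noteq> v \<and> (u1 \<sim> x \<or> u2 \<sim> x) \<and> (x \<sim> a' \<or> x \<sim> b')})"
          using facts u(3) \<open>\<not> u1 \<sim> u2\<close> by (simp add: g_def)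
        also have "{x. x \<noteq> v \<and> (u1 \<sim> x \<or> u2 \<sim> x) \<and> (x \<sim> a' \<or> x \<sim> b')} = {a, b}"
        proof -
          have aa: "x = a" if "u1 \<sim> x" "x \<sim> a'" for x
            using common_neighbour_unique[of u1 a' x a] that 3 a' sym by metis
          have bb: "x = b" if "u2 \<sim> x" "x \<sim> b'" for x
            using common_neighbour_unique[of u2 b' x b] that 3 b' sym by metis
          have ab': False if "u1 \<sim> x" "x \<sim> b'" "x \<noteq> v" for x
          proof -
            have "x \<noteq> u1" "x \<noteq> b'" "x \<noteq> b" "x \<noteq> u2"
              using that nab \<open>\<not> u1 \<sim> u2\<close> sym adj_not_same by metis+
            then show False
              using no_cyclic_list[of "[v, u1, x, b', b, u2]"] that 3 b' u facts ab(1,2)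
              by (auto simp: adjacent_sym)
          qed
          have ba: False if "u2 \<sim> x" "x \<sim> a'" "x \<noteq> v" for x
          proof -
            have "x \<noteq> u2" "x \<noteq> a'" "x \<noteq> a" "x \<noteq> u1"
              using that nab \<open>\<not> u1 \<sim> u2\<close> sym adj_not_same by metis+
            then show False
              using no_cyclic_list[of "[v, u2, x, a', a, u1]"] that 3 a' u facts ab(1,2)
              by (auto simp: adjacent_sym)
          qed
          show ?thesis
          proof (intro equalityI subsetI)
            fix x assume "x \<in> {x. x \<noteq> v \<and> (u1 \<sim> x \<or> u2 \<sim> x) \<and> (x \<sim> a' \<or> x \<sim> b')}"
            then show "x \<in> {a, b}"
              unfolding mem_Collect_eq insert_iff using aa bb ab' ba by metis
          next
            fix x assume "x \<in> {a, b}"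
            then consider "x = a" | "x = b" by blast
            then show "x \<in> {x. x \<noteq> v \<and> (u1 \<sim> x \<or> u2 \<sim> x) \<and> (x \<sim> a' \<or> x \<sim> b')}"
              using ab(1,2) 3 a'(1) b'(1) by cases simp_all
          qed
        qed
        finally show ?thesis using S_eq Q_eq by simp
      qed
      ultimately show ?thesis by blast
    qed
  qed
qed

text \<open>
  If no leaf lies within distance two of \<open>v\<close>, then an arbitrary leaf will do; the absence of leaves
  close to \<open>v\<close> is what allows paths from \<open>v\<close> to be extended.
\<close>
lemma internal_star_le_leaf_star:
  assumes v: "internal_vertex G v" and "r \<le> 4" and "verts G \<noteq> {}"
  shows "\<exists>l. leaf G l \<and> card (star G r v) \<le> card (star G r l)"
proof (cases "\<exists>l. leaf G l \<and> (\<forall>p. l \<sim> p \<longrightarrow> p = v \<or> v \<sim> p)")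
  case True
  then show ?thesis using near_leaf_star_ge by blast
next
  case False
  obtain l where l: "leaf G l" using leaf_exists assms(3) by blast
  then obtain p where "l \<sim> p" "p \<noteq> v" "\<not> v \<sim> p" using False by blast
  moreover obtain u1 where "v \<sim> u1" using internal_vertex_other_neighbour[OF v] by blast
  moreover obtain u2 where "v \<sim> u2" "u2 \<noteq> u1" using internal_vertex_other_neighbour[OF v] by blast
  moreover have "\<exists>z. y \<sim> z \<and> z \<noteq> x" if "v \<sim> x" "x \<sim> y" for x y
  proof -
    have "\<not> leaf G y"
      using False that leaf_neighbour_unique[of y] adjacent_sym by metis
    then have "internal_vertex G y"
      using that adj_in_verts by (auto simp: leaf_def)
    then show ?thesis by (metis internal_vertex_other_neighbour)
  qed
  ultimately show ?thesis using far_leaf_star_ge[OF l, of p v u1 u2 r] l \<open>r \<le> 4\<close> by blast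
qed

end

section \<open>Maximum stars of trees\<close>

theorem theorem1p26:
  fixes T :: "('a, 'b) pre_digraph" and r :: nat
  assumes "undirected_tree T" and "1 \<le> r" and "r \<le> 4"
  shows "\<exists>x. leaf T x \<and> (\<forall>v\<in>verts T. card (star T r v) \<le> card (star T r x))"
proof -
  interpret graph T using assms(1) by (simp add: undirected_tree_def)
  interpret forest T
    using assms(1) by unfold_locales (auto simp: undirected_tree_def)
  have ne: "verts T \<noteq> {}"
    using assms(1) by (auto simp: undirected_tree_def connected_def strongly_connected_def)
  define stars where "stars = (\<lambda>x. card (star T r x)) ` {x. leaf T x}"
  have "finite stars"
    unfolding stars_def leaf_def by simp
  moreover have "stars \<noteq> {}" using leaf_exists[OF ne] by (simp add: stars_def)
  ultimately have "Max stars \<in> stars" and Max: "\<And>n. n \<in> stars \<Longrightarrow> n \<le> Max stars" by simp_all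
  then obtain x where x: "leaf T x" "card (star T r x) = Max stars" by (auto simp: stars_def)
  then have max: "card (star T r y) \<le> card (star T r x)" if "leaf T y" for y
    using that Max by (simp add: stars_def)
  have "card (star T r v) \<le> card (star T r x)" if "v \<in> verts T" for v
  proof (cases "leaf T v")
    case False
    then have "internal_vertex T v" using that by (simp add: leaf_def)
    then show ?thesis
      using internal_star_le_leaf_star[OF _ assms(3) ne] max le_trans by blast
  qed (rule max)
  then show ?thesis using x by blast
qed

end
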